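(* Let $\beta=2$. For every positive integer $p$, $$S_2(p)=[(01^{p-1})^\infty]_2 .$$
   Context: For $\beta\in(1,2]$ let $T_\beta:[0,1)\to[0,1)$, $T_\beta(x)=\beta x \pmod 1$. For $t\in[0,1)$ the survivor set is $K_\beta(t)=\{x\in[0,1): T_\beta^n(x)\ge t \text{ for all } n\ge 0\}$. A point $x$ has smallest period $p$ if $T_\beta^p(x)=x$ and $T_\beta^j(x)\ne x$ for all $1\le j<p$. For a positive integer $p$, $$S_\beta(p)=\sup\{t\in[0,1): K_\beta(t)\text{ contains a point of smallest period } p\}.$$ For a sequence $(x_i)_{i\ge1}\in\{0,1\}^{\mathbb N}$ write $[(x_1x_2x_3\cdots)]_\beta=\sum_{i\ge1}x_i\beta^{-i}$. For a finite word $w$ over $\{0,1\}$, $w^k$ is the $k$-fold concatenation of $w$ with itself ($w^0$ is the empty word) and $w^\infty$ is the infinite periodic sequence $www\cdots$; thus $(01^{p-1})^\infty$ is the periodic repetition of the word consisting of one $0$ followed by $p-1$ ones. *)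

theory Defs
  imports Complex_Main
begin

text \<open>The base \<open>\<beta>\<close> is meant to lie in \<open>(1,2]\<close>; the map is used on \<open>[0,1)\<close> only.\<close>

definition beta_map :: "real \<Rightarrow> real \<Rightarrow> real" where
  "beta_map \<beta> x = frac (\<beta> * x)"

definition survivor_set :: "real \<Rightarrow> real \<Rightarrow> real set" where
  "survivor_set \<beta> t = {x \<in> {0..<1}. \<forall>n. (beta_map \<beta> ^^ n) x \<ge> t}"

definition smallest_period :: "real \<Rightarrow> nat \<Rightarrow> real \<Rightarrow> bool" where
  "smallest_period \<beta> p x \<longleftrightarrow>
     (beta_map \<beta> ^^ p) x = x \<and> (\<forall>j. 1 \<le> j \<and> j < p \<longrightarrow> (beta_map \<beta> ^^ j) x \<noteq> x)"

definition S_beta :: "real \<Rightarrow> nat \<Rightarrow> real" where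
  "S_beta \<beta> p = Sup {t \<in> {0..<1}. \<exists>x \<in> survivor_set \<beta> t. smallest_period \<beta> p x}"

text \<open>Sequences are indexed from \<open>0\<close>: \<open>x i\<close> is the digit at position \<open>i + 1\<close>,
  hence the exponent \<open>Suc i\<close>.\<close>

definition beta_value :: "real \<Rightarrow> (nat \<Rightarrow> nat) \<Rightarrow> real" where
  "beta_value \<beta> x = (\<Sum>i. real (x i) / \<beta> ^ Suc i)"

text \<open>The infinite periodic sequence \<open>www\<dots>\<close> of a nonempty word \<open>w\<close>.\<close>

definition periodic_seq :: "'a list \<Rightarrow> nat \<Rightarrow> 'a" where
  "periodic_seq w i = w ! (i mod length w)"

end

theory Submission
  imports Defs
begin

text \<open>
  Put \<open>N = 2 ^ p - 1\<close> and \<open>v = (2 ^ (p - 1) - 1) / N\<close>. The supremum is a maximum,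
  attained at \<open>t = v\<close> by the orbit of \<open>v\<close> itself.

  \<^emph>\<open>Lower bound.\<close> Away from its lowest point, the doubling map doubles the distance to \<open>1\<close>
  along the orbit of \<open>v\<close>. Starting right after \<open>v\<close> these distances are
  \<open>1 / N, 2 / N, \<dots>, 2 ^ (p - 1) / N\<close>, the last one belonging to \<open>v\<close> again
  (\<open>funpow_doubling_cycle\<close>). So \<open>v\<close> is the minimum of its orbit, its smallest period is \<open>p\<close>,
  and reading off the digits gives \<open>0 1 \<dots> 1\<close> repeated; the value of this digit sequence is \<open>v\<close>
  by telescoping (\<open>sums_of_digit_recurrence\<close>).

  \<^emph>\<open>Upper bound.\<close> A point fixed by the \<open>p\<close>-th iterate is a multiple of \<open>1 / N\<close>, and \<open>v\<close> is the
  largest such multiple below \<open>1 / 2\<close>. An orbit staying strictly above \<open>v\<close> would therefore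
  stay above \<open>1 / 2\<close> (\<open>periodic_above_threshold\<close>). But there the doubling map doubles the
  distance to \<open>1\<close> at every step, which is impossible for a periodic orbit in \<open>[0,1)\<close>.
\<close>

section \<open>Digit expansions\<close>

text \<open>The recurrence says \<open>d n / \<beta> ^ Suc n = y n / \<beta> ^ n - y (Suc n) / \<beta> ^ Suc n\<close>, so the
  series telescopes, and boundedness of \<open>y\<close> makes the remainder vanish.\<close>

lemma sums_of_digit_recurrence:
  fixes \<beta> :: real and y :: "nat \<Rightarrow> real" and d :: "nat \<Rightarrow> nat"
  assumes \<beta>: "\<beta> > 1" and y: "\<And>n. \<bar>y n\<bar> \<le> B"
    and rec: "\<And>n. y (Suc n) = \<beta> * y n - real (d n)"
  shows "(\<lambda>n. real (d n) / \<beta> ^ Suc n) sums y 0"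
proof -
  have inverse_power: "(\<lambda>n. inverse \<beta> ^ n) \<longlonglongrightarrow> 0"
    by (rule LIMSEQ_power_zero) (use \<beta> in \<open>simp add: inverse_less_1_iff\<close>)
  have "norm (y n / \<beta> ^ n) \<le> norm (inverse \<beta> ^ n) * B" for n
  proof -
    have "norm (y n / \<beta> ^ n) = norm (inverse \<beta> ^ n) * \<bar>y n\<bar>"
      by (simp add: divide_inverse power_inverse abs_mult)
    then show ?thesis using y[of n] by (simp only: mult_left_mono norm_ge_zero)
  qed
  then have "(\<lambda>n. y n / \<beta> ^ n) \<longlonglongrightarrow> 0"
    by (intro tendsto_0_le[OF inverse_power, of _ B] always_eventually allI)
  then have "(\<lambda>n. y n / \<beta> ^ n - y (Suc n) / \<beta> ^ Suc n) sums (y 0 / \<beta> ^ 0 - 0)"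
    by (rule telescope_sums')
  moreover have "y n / \<beta> ^ n - y (Suc n) / \<beta> ^ Suc n = real (d n) / \<beta> ^ Suc n" for n
    using \<beta> by (simp add: rec field_simps)
  ultimately show ?thesis by simp
qed

section \<open>The orbit with digits 0 1 ... 1\<close>

text \<open>The index is shifted by \<open>p - 1\<close> so that position \<open>0\<close> is the lowest point of the cycle,
  the one with the largest distance \<open>2 ^ (p - 1) / (2 ^ p - 1)\<close> to \<open>1\<close>.\<close>

definition doubling_cycle :: "nat \<Rightarrow> nat \<Rightarrow> real" where
  "doubling_cycle p n = 1 - 2 ^ ((n + (p - 1)) mod p) / (2 ^ p - 1)"

lemma doubling_cycle_0:
  assumes "p \<ge> 1"
  shows "doubling_cycle p 0 = (2 ^ (p - 1) - 1) / (2 ^ p - 1)"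
proof -
  obtain q where "p = Suc q" using assms by (cases p) auto
  moreover have "(2::real) ^ Suc q > 1" by (rule one_less_power) auto
  ultimately show ?thesis by (simp add: doubling_cycle_def field_simps)
qed

lemma shifted_mod_eq_iff:
  fixes n p :: nat
  assumes "p \<ge> 1"
  shows "(n + (p - 1)) mod p = p - 1 \<longleftrightarrow> n mod p = 0"
proof -
  define r where "r = (n + (p - 1)) mod p"
  have "Suc (n + (p - 1)) = n + p" using assms by simp
  then have "n mod p = (if Suc r = p then 0 else Suc r)"
    unfolding r_def by (metis mod_Suc mod_add_self2)
  then show ?thesis using assms unfolding r_def[symmetric] by auto
qed

lemma doubling_cycle_recurrence:
  assumes p: "p \<ge> 1"
  shows "doubling_cycle p (Suc n) =
    2 * doubling_cycle p n - real (periodic_seq (0 # replicate (p - 1) 1) n)"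
proof -
  define e where "e = (n + (p - 1)) mod p"
  have N: "(2::real) ^ p > 1" using p by (intro one_less_power) auto
  have next_e: "(Suc n + (p - 1)) mod p = (if Suc e = p then 0 else Suc e)"
    unfolding e_def add_Suc mod_Suc ..
  have wrap: "n mod p = 0 \<longleftrightarrow> Suc e = p"
    using p unfolding shifted_mod_eq_iff[OF p, symmetric] e_def[symmetric] by auto
  have "length (0 # replicate (p - 1) (1::nat)) = p" using p by simp
  then have digit: "periodic_seq (0 # replicate (p - 1) (1::nat)) n =
      (0 # replicate (p - 1) 1) ! (n mod p)"
    unfolding periodic_seq_def by (rule arg_cong)
  show ?thesis
  proof (cases "Suc e = p")
    case True
    then have "n mod p = 0" by (simp add: wrap)
    then have "periodic_seq (0 # replicate (p - 1) (1::nat)) n = 0"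
      unfolding digit by simp
    moreover have "(2::real) ^ p = 2 * 2 ^ e" using True by (metis power_Suc)
    ultimately show ?thesis
      using N True unfolding doubling_cycle_def next_e e_def[symmetric]
      by (simp add: field_simps)
  next
    case False
    then have "n mod p \<noteq> 0" by (simp add: wrap)
    moreover have "n mod p < p" using p by simp
    ultimately have "periodic_seq (0 # replicate (p - 1) (1::nat)) n = 1"
      unfolding digit by (simp add: nth_Cons')
    then show ?thesis
      using N False unfolding doubling_cycle_def next_e e_def[symmetric]
      by (simp add: field_simps)
  qed
qed

lemma doubling_cycle_ge:
  assumes p: "p \<ge> 1"
  shows "doubling_cycle p n \<ge> doubling_cycle p 0"
proof -
  have "(n + (p - 1)) mod p < p" using p by (intro mod_less_divisor) auto
  then have "(n + (p - 1)) mod p \<le> (0 + (p - 1)) mod p"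
    using p unfolding add_0 by (subst (2) mod_less) linarith+
  then have "(2::real) ^ ((n + (p - 1)) mod p) \<le> 2 ^ ((0 + (p - 1)) mod p)"
    by (intro power_increasing) auto
  moreover have "(2::real) ^ p > 1" using p by (intro one_less_power) auto
  ultimately show ?thesis
    unfolding doubling_cycle_def by (intro diff_left_mono divide_right_mono) auto
qed

lemma doubling_cycle_range:
  assumes p: "p \<ge> 1"
  shows "doubling_cycle p n \<in> {0..<1}"
proof -
  have "(2::real) ^ p > 1" using p by (intro one_less_power) auto
  moreover have "(2::real) ^ (p - 1) \<ge> 1" by simp
  ultimately have "doubling_cycle p 0 \<ge> 0" "doubling_cycle p n < 1"
    using p unfolding doubling_cycle_0[OF p] by (auto simp: doubling_cycle_def)
  then show ?thesis using doubling_cycle_ge[OF p, of n] by auto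
qed

lemma doubling_cycle_eq_start_iff:
  assumes p: "p \<ge> 1"
  shows "doubling_cycle p n = doubling_cycle p 0 \<longleftrightarrow> n mod p = 0"
proof -
  have "(2::real) ^ p > 1" using p by (intro one_less_power) auto
  then have "doubling_cycle p n = doubling_cycle p 0 \<longleftrightarrow>
      (n + (p - 1)) mod p = (0 + (p - 1)) mod p"
    by (simp add: doubling_cycle_def)
  then show ?thesis using shifted_mod_eq_iff[OF p, of n] p by simp
qed

text \<open>Consecutive points of the cycle satisfy \<open>y (n + 1) = 2 y n - d n\<close> with an integer digit and
  lie in \<open>[0,1)\<close>, so subtracting the digit is the same as taking the fractional part.\<close>

lemma funpow_doubling_cycle:
  assumes p: "p \<ge> 1"
  shows "(beta_map 2 ^^ n) (doubling_cycle p 0) = doubling_cycle p n"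
proof (induction n)
  case (Suc n)
  have "frac (2 * doubling_cycle p n) = doubling_cycle p (Suc n)"
    using doubling_cycle_range[OF p, of "Suc n"]
    by (simp add: frac_unique_iff doubling_cycle_recurrence[OF p])
  then show ?case unfolding funpow.simps comp_apply Suc by (simp add: beta_map_def)
qed simp

lemma beta_value_doubling_cycle:
  assumes p: "p \<ge> 1"
  shows "beta_value 2 (periodic_seq (0 # replicate (p - 1) 1)) = doubling_cycle p 0"
proof -
  have "\<bar>doubling_cycle p n\<bar> \<le> 1" for n
    using doubling_cycle_range[OF p, of n] by auto
  then show ?thesis
    unfolding beta_value_def
    by (intro sums_unique[symmetric] sums_of_digit_recurrence doubling_cycle_recurrence p) auto
qed

section \<open>Periodic orbits of the doubling map\<close>

lemma funpow_beta_map_diff_Ints: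
  "2 ^ n * x - (beta_map 2 ^^ n) x \<in> \<int>"
proof (induction n)
  case (Suc n)
  let ?y = "(beta_map 2 ^^ n) x"
  have "2 * (2 ^ n * x - ?y) + of_int \<lfloor>2 * ?y\<rfloor> \<in> \<int>"
    using Suc by (intro Ints_add Ints_mult) auto
  also have "2 * (2 ^ n * x - ?y) + of_int \<lfloor>2 * ?y\<rfloor> = 2 ^ Suc n * x - beta_map 2 ?y"
    by (simp add: beta_map_def frac_def algebra_simps)
  finally show ?case by simp
qed simp

text \<open>Such a point is a multiple of \<open>1 / (2 ^ p - 1)\<close>, and no multiple lies strictly between the
  threshold and \<open>1 / 2\<close>, since the next one is \<open>2 ^ (p - 1) / (2 ^ p - 1)\<close>.\<close>

lemma periodic_above_threshold:
  assumes p: "p \<ge> 1" and per: "(beta_map 2 ^^ p) y = y"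
    and gt: "y > (2 ^ (p - 1) - 1) / (2 ^ p - 1)"
  shows "y > 1 / 2"
proof -
  obtain k :: int where k: "2 ^ p * y - y = of_int k"
    using funpow_beta_map_diff_Ints[of p y] per by (auto elim: Ints_cases)
  have N: "(2::real) ^ p > 1" using p by (intro one_less_power) auto
  then have "of_int (2 ^ (p - 1) - 1) < real_of_int k"
    using gt by (simp add: k[symmetric] field_simps)
  then have "2 ^ (p - 1) \<le> k" unfolding of_int_less_iff by simp
  then have "real_of_int (2 ^ (p - 1)) \<le> of_int k" by (simp only: of_int_le_iff)
  moreover have "(2::real) ^ p = 2 * 2 ^ (p - 1)" using p by (cases p) auto
  ultimately have "(2 ^ p - 1) * y > (2 ^ p - 1) * (1 / 2)"
    unfolding k[symmetric] by (simp add: algebra_simps)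
  then show ?thesis using N by (simp only: mult_less_cancel_left_pos diff_gt_0_iff_gt)
qed

lemma beta_map_range: "beta_map \<beta> x \<in> {0..<1}"
  by (simp add: beta_map_def frac_lt_1)

lemma dist_to_one_doubles:
  assumes x: "x \<in> {0..<1}" and half: "\<And>n. (beta_map 2 ^^ n) x \<ge> 1 / 2"
  shows "1 - (beta_map 2 ^^ n) x = 2 ^ n * (1 - x)"
proof (induction n)
  case (Suc n)
  let ?y = "(beta_map 2 ^^ n) x"
  have "?y < 1" using x beta_map_range by (cases n) auto
  then have "frac (2 * ?y) = 2 * ?y - 1"
    using half[of n] by (simp add: frac_unique_iff)
  then have "beta_map 2 ?y = 2 * ?y - 1" by (simp add: beta_map_def)
  then show ?case using Suc by (simp add: algebra_simps)
qed simp

lemma periodic_orbit_below_threshold: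
  assumes p: "p \<ge> 1" and x: "x \<in> {0..<1}" and per: "(beta_map 2 ^^ p) x = x"
  shows "\<exists>n. (beta_map 2 ^^ n) x \<le> (2 ^ (p - 1) - 1) / (2 ^ p - 1)"
proof (rule ccontr)
  assume above: "\<not> ?thesis"
  have "(beta_map 2 ^^ n) x \<ge> 1 / 2" for n
  proof -
    have "(beta_map 2 ^^ p) ((beta_map 2 ^^ n) x) = (beta_map 2 ^^ n) ((beta_map 2 ^^ p) x)"
      by (metis add.commute comp_apply funpow_add)
    then show ?thesis
      using periodic_above_threshold[OF p, of "(beta_map 2 ^^ n) x"] above per
      by (force simp: not_le)
  qed
  then have "1 - x = 2 ^ p * (1 - x)"
    using dist_to_one_doubles[OF x, of p] per by simp
  moreover have "(2::real) ^ p > 1" using p by (intro one_less_power) auto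
  ultimately show False using x by simp
qed

section \<open>The supremum for smallest period p\<close>

theorem theorem3p1:
  fixes p :: nat
  assumes "p \<ge> 1"
  shows "S_beta 2 p = beta_value 2 (periodic_seq (0 # replicate (p - 1) 1))"
proof -
  let ?v = "doubling_cycle p 0"
  have "smallest_period 2 p ?v"
    using doubling_cycle_eq_start_iff[OF assms]
    by (auto simp: smallest_period_def funpow_doubling_cycle[OF assms])
  moreover have "?v \<in> survivor_set 2 ?v"
    using doubling_cycle_range[OF assms] doubling_cycle_ge[OF assms]
    by (simp add: survivor_set_def funpow_doubling_cycle[OF assms])
  ultimately have "?v \<in> {t \<in> {0..<1}. \<exists>x \<in> survivor_set 2 t. smallest_period 2 p x}"
    using doubling_cycle_range[OF assms] by blast
  moreover have "t \<le> ?v" if "x \<in> survivor_set 2 t" "smallest_period 2 p x" for t x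
    using periodic_orbit_below_threshold[OF assms, of x] that
    unfolding doubling_cycle_0[OF assms] survivor_set_def smallest_period_def
    by (blast intro: order_trans)
  ultimately have "S_beta 2 p = ?v"
    unfolding S_beta_def by (intro cSup_eq_maximum) auto
  then show ?thesis unfolding beta_value_doubling_cycle[OF assms] .
qed

end
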